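(* Let $u\in\mathcal P'$ be a regular linear form with $(u)_0=1$, and let $$\Phi(x)=\sum_{\nu=0}^{t}c_\nu x^\nu,\qquad \psi(x)=\sum_{\nu=0}^{p}a_\nu x^\nu,\qquad B(x)=\sum_{\nu=0}^{q}b_\nu x^\nu$$ be polynomials with complex coefficients, $\Phi$ not identically zero. The following statements are equivalent: (a) $u$ is a Laguerre-Hahn form satisfying the functional equation $$(\Phi u)'+\psi u+B(x^{-1}u^2)=0.$$ (b) The moments of $u$ satisfy, for all integers $n\ge0$, $$-n\sum_{\nu=0}^{t}c_\nu(u)_{n-1+\nu}+\sum_{\nu=0}^{p}a_\nu(u)_{n+\nu}+\sum_{\nu=0}^{q}b_\nu\sum_{\mu=0}^{n+\nu-1}(u)_\mu(u)_{n+\nu-\mu-1}=0.$$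
   Context: $\mathcal P$ is the vector space of polynomials in one variable with complex coefficients and $\mathcal P'$ its algebraic dual; elements of $\mathcal P'$ are called (linear) forms. The moments of $u\in\mathcal P'$ are $(u)_n:=\langle u,x^n\rangle$, $n\ge0$. Conventions: $(u)_k=0$ for $k<0$, and empty sums are $0$. A form $u$ is regular if there is a sequence of polynomials $\{P_n\}_{n\ge0}$ with $\deg P_n=n$ and $\langle u,P_nP_m\rangle=r_n\delta_{n,m}$ with $r_n\ne0$ for all $n,m\ge0$. Operations on forms, for $f,p\in\mathcal P$ and $u,v\in\mathcal P'$: $\langle fu,p\rangle=\langle u,fp\rangle$; $\langle u',p\rangle=-\langle u,p'\rangle$; $\langle x^{-1}u,p\rangle=\langle u,\theta_0p\rangle$ with $(\theta_0p)(x)=\frac{p(x)-p(0)}{x}$; $(uf)(x):=\bigl\langle u,\frac{xf(x)-\zeta f(\zeta)}{x-\zeta}\bigr\rangle$ (where $u$ acts on the variable $\zeta$), and the Cauchy product $uv$ is defined by $\langle uv,f\rangle:=\langle u,vf\rangle$; $u^2:=uu$. A regular form $u$ with $(u)_0=1$ is a Laguerre-Hahn form if there are polynomials $\Phi\not\equiv0$, $\psi$, $B$ such that $(\Phi u)'+\psi u+B(x^{-1}u^2)=0$. (This is equivalent to the formal Stieltjes function $S(u)(z)=-\sum_{n\ge0}(u)_n z^{-n-1}$ satisfying a Riccati equation $\Phi S'(u)=BS^2(u)+CS(u)+D$ with polynomial coefficients, where $C=-\Phi'-\psi$.) *)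

theory Defs
  imports
    "HOL-Computational_Algebra.Computational_Algebra"
    "HOL-Library.Function_Algebras"
begin

type_synonym form = "complex poly \<Rightarrow> complex"

text \<open>Forms are functions satisfying the predicate below; addition of forms and the zero form are
  the pointwise ones from \<^theory>\<open>HOL-Library.Function_Algebras\<close>.\<close>

definition linear_form :: "form \<Rightarrow> bool" where
  "linear_form u \<longleftrightarrow> Vector_Spaces.linear smult (*) u"

definition moment :: "form \<Rightarrow> int \<Rightarrow> complex" where
  "moment u k = (if k < 0 then 0 else u (monom 1 (nat k)))"

definition regular_form :: "form \<Rightarrow> bool" where
  "regular_form u \<longleftrightarrow>
     (\<exists>(P :: nat \<Rightarrow> complex poly) (r :: nat \<Rightarrow> complex).
        (\<forall>n. degree (P n) = n) \<and>
        (\<forall>n. r n \<noteq> 0) \<and>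
        (\<forall>n m. u (P n * P m) = (if n = m then r n else 0)))"

definition mult_form :: "complex poly \<Rightarrow> form \<Rightarrow> form" where
  "mult_form f u = (\<lambda>p. u (f * p))"

definition deriv_form :: "form \<Rightarrow> form" where
  "deriv_form u = (\<lambda>p. - u (pderiv p))"

definition theta0 :: "complex poly \<Rightarrow> complex poly" where
  "theta0 p = (p - [:poly p 0:]) div [:0, 1:]"

definition xinv_form :: "form \<Rightarrow> form" where
  "xinv_form u = (\<lambda>p. u (theta0 p))"

text \<open>Polynomials in \<open>x\<close> and \<open>\<zeta>\<close> are represented as polynomials in \<open>x\<close> whose coefficients are
  polynomials in \<open>\<zeta>\<close>. Hence \<open>g(x)\<close> becomes \<open>map_poly (\<lambda>c. [:c:]) g\<close>, \<open>g(\<zeta>)\<close> becomes \<open>[:g:]\<close>,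
  and \<open>x - \<zeta>\<close> becomes \<open>[:- [:0, 1:], 1:]\<close>.\<close>

definition diff_quot :: "complex poly \<Rightarrow> complex poly poly" where
  "diff_quot g = (map_poly (\<lambda>c. [:c:]) g - [:g:]) div [:- [:0, 1:], 1:]"

lemma diff_quot_exact:
  "[:- [:0, 1:], 1:] * diff_quot g = map_poly (\<lambda>c. [:c:]) g - [:g:]"
proof -
  have "poly (map_poly (\<lambda>c. [:c:]) g) [:0, 1:] = g"
    by (induction g) (simp_all add: map_poly_pCons)
  then have "[:- [:0, 1:], 1:] dvd (map_poly (\<lambda>c. [:c:]) g - [:g:])"
    by (intro poly_eq_0_iff_dvd[THEN iffD1]) simp
  then show ?thesis
    unfolding diff_quot_def by (rule dvd_mult_div_cancel)
qed

text \<open>\<open>(uf)(x) = \<langle>u, (x f(x) - \<zeta> f(\<zeta>)) / (x - \<zeta>)\<rangle>\<close> with \<open>u\<close> acting on \<open>\<zeta>\<close>, i.e. on the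
  coefficients.\<close>

definition form_poly :: "form \<Rightarrow> complex poly \<Rightarrow> complex poly" where
  "form_poly u f = map_poly u (diff_quot ([:0, 1:] * f))"

definition cauchy_prod :: "form \<Rightarrow> form \<Rightarrow> form" where
  "cauchy_prod u v = (\<lambda>f. u (form_poly v f))"

definition LH_equation :: "complex poly \<Rightarrow> complex poly \<Rightarrow> complex poly \<Rightarrow> form \<Rightarrow> bool" where
  "LH_equation \<Phi> \<psi> B u \<longleftrightarrow>
     deriv_form (mult_form \<Phi> u) + mult_form \<psi> u
       + mult_form B (xinv_form (cauchy_prod u u)) = 0"

definition Laguerre_Hahn_form :: "form \<Rightarrow> bool" where
  "Laguerre_Hahn_form u \<longleftrightarrow>
     linear_form u \<and> regular_form u \<and> moment u 0 = 1 \<and>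
     (\<exists>\<Phi> \<psi> B. \<Phi> \<noteq> 0 \<and> LH_equation \<Phi> \<psi> B u)"

end

theory Submission
  imports Defs
begin

text \<open>Both sides of the functional equation are linear forms, so the equation holds iff it holds on
  all monomials \<open>x\<^sup>n\<close>. There, \<open>(\<Phi>u)'\<close> and \<open>\<psi>u\<close> give the first two sums directly, and the third one
  comes from the convolution formula \<open>(uv)\<^sub>n = \<Sum>\<^sub>i (u)\<^sub>i (v)\<^sub>n\<^sub>-\<^sub>i\<close>, which follows from the
  geometric factorisation of \<open>x\<^sup>n\<^sup>+\<^sup>1 - \<zeta>\<^sup>n\<^sup>+\<^sup>1\<close>.\<close>

lemma linear_form_iff:
  "linear_form u \<longleftrightarrow> (\<forall>p q. u (p + q) = u p + u q) \<and> (\<forall>k p. u (smult k p) = k * u p)"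
proof -
  have "vector_space (smult :: complex \<Rightarrow> complex poly \<Rightarrow> complex poly)"
    by unfold_locales (auto simp: smult_add_right smult_add_left)
  moreover have "vector_space ((*) :: complex \<Rightarrow> complex \<Rightarrow> complex)"
    by unfold_locales (auto simp: algebra_simps)
  ultimately show ?thesis
    unfolding linear_form_def Vector_Spaces.linear_def module_hom_def module_hom_axioms_def
    by (auto dest: module_iff_vector_space[THEN iffD2])
qed

lemma linear_formI:
  assumes "\<And>p q. u (p + q) = u p + u q" and "\<And>k p. u (smult k p) = k * u p"
  shows "linear_form u"
  using assms by (simp add: linear_form_iff)

lemma linear_form_add: "linear_form u \<Longrightarrow> u (p + q) = u p + u q"
  by (simp add: linear_form_iff)

lemma linear_form_smult: "linear_form u \<Longrightarrow> u (smult k p) = k * u p"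
  by (simp add: linear_form_iff)

lemma linear_form_0: "linear_form u \<Longrightarrow> u 0 = 0"
  using linear_form_smult[of u 0 0] by simp

lemma linear_form_sum: "linear_form u \<Longrightarrow> u (sum f A) = (\<Sum>x\<in>A. u (f x))"
  by (induction A rule: infinite_finite_induct) (simp_all add: linear_form_0 linear_form_add)

lemma linear_form_monom: "linear_form u \<Longrightarrow> u (monom k n) = k * u (monom 1 n)"
  using linear_form_smult[of u k "monom 1 n"] by (simp add: smult_monom)

text \<open>Every polynomial is a finite combination of monomials, so the moments determine a linear
  form.\<close>

lemma linear_form_eq_0_iff:
  assumes "linear_form u"
  shows "u = 0 \<longleftrightarrow> (\<forall>n. u (monom 1 n) = 0)"
proof
  assume *: "\<forall>n. u (monom 1 n) = 0"
  have "u p = 0" for p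
  proof -
    have "u p = u (\<Sum>i\<le>degree p. monom (coeff p i) i)"
      by (simp add: poly_as_sum_of_monoms)
    also have "\<dots> = 0"
      unfolding linear_form_sum[OF assms]
    proof (rule sum.neutral, rule ballI)
      show "u (monom (coeff p i) i) = 0" for i
        by (subst linear_form_monom[OF assms]) (simp add: *)
    qed
    finally show ?thesis .
  qed
  then show "u = 0" by (simp add: fun_eq_iff)
qed simp

lemma linear_form_plus: "linear_form u \<Longrightarrow> linear_form v \<Longrightarrow> linear_form (u + v)"
  by (simp add: linear_form_iff algebra_simps)

lemma linear_form_mult_form: "linear_form u \<Longrightarrow> linear_form (mult_form f u)"
  by (simp add: linear_form_iff mult_form_def distrib_left)

lemma linear_form_deriv_form: "linear_form u \<Longrightarrow> linear_form (deriv_form u)"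
  by (simp add: linear_form_iff deriv_form_def pderiv_add pderiv_smult)

text \<open>Since \<open>pCons a p\<close> is a + x p(x), removing the value at 0 and dividing by x
  leaves p. Every polynomial has this shape, so the properties of \<open>theta0\<close> follow by
  cases.\<close>

lemma theta0_pCons: "theta0 (pCons a p) = p"
proof -
  have "pCons a p - [:a:] = p * [:0, 1:]" by simp
  then show ?thesis
    \<comment> \<open>The factor x must stay visible as \<open>[:0, 1:]\<close> for the division to
      cancel it.\<close>
    unfolding theta0_def by (simp del: mult_pCons_right)
qed

lemma theta0_add: "theta0 (p + q) = theta0 p + theta0 q"
  by (cases p; cases q) (simp add: theta0_pCons)

lemma theta0_smult: "theta0 (smult k p) = smult k (theta0 p)"
  by (cases p) (simp add: theta0_pCons)

lemma theta0_monom: "theta0 (monom k n) = (if n = 0 then 0 else monom k (n - 1))"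
  by (cases n) (simp_all add: monom_0 monom_Suc theta0_pCons)

lemma linear_form_xinv_form: "linear_form u \<Longrightarrow> linear_form (xinv_form u)"
  by (simp add: linear_form_iff xinv_form_def theta0_add theta0_smult)

text \<open>The divisor x - \<zeta> is nonzero in an integral domain, so the quotient is unique.
  Identities for \<open>diff_quot\<close> can thus be checked after multiplication by x - \<zeta>,
  without handling \<open>div\<close>.\<close>

lemma diff_quot_eqI:
  assumes "[:- [:0, 1:], 1:] * r = map_poly (\<lambda>c. [:c:]) g - [:g:]"
  shows "diff_quot g = r"
  unfolding diff_quot_def assms[symmetric]
  by (rule nonzero_mult_div_cancel_left) simp

lemma diff_quot_add: "diff_quot (f + g) = diff_quot f + diff_quot g"
proof (rule diff_quot_eqI)
  have "map_poly (\<lambda>c. [:c:]) (f + g) = map_poly (\<lambda>c. [:c:]) f + map_poly (\<lambda>c. [:c:]) g"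
    by (intro poly_eqI) (simp add: coeff_map_poly)
  then show "[:- [:0, 1:], 1:] * (diff_quot f + diff_quot g)
      = map_poly (\<lambda>c. [:c:]) (f + g) - [:f + g:]"
    unfolding distrib_left diff_quot_exact by simp
qed

lemma diff_quot_smult: "diff_quot (smult k g) = smult [:k:] (diff_quot g)"
proof (rule diff_quot_eqI)
  have "map_poly (\<lambda>c. [:c:]) (smult k g) = smult [:k:] (map_poly (\<lambda>c. [:c:]) g)"
    by (intro poly_eqI) (simp add: coeff_map_poly mult.commute)
  then show "[:- [:0, 1:], 1:] * smult [:k:] (diff_quot g)
      = map_poly (\<lambda>c. [:c:]) (smult k g) - [:smult k g:]"
    unfolding mult_smult_right diff_quot_exact by (simp add: smult_diff_right)
qed

text \<open>This is x^(n+1) - \<zeta>^(n+1) = (x - \<zeta>) (\<Sum>i\<le>n. \<zeta>^(n-i) x^i); the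
  outer monomial carries the power of x, the inner one that of \<zeta>.\<close>

lemma diff_quot_monom:
  "diff_quot (monom 1 (Suc n)) = (\<Sum>i\<le>n. monom (monom 1 (n - i)) i)"
proof (rule diff_quot_eqI)
  \<comment> \<open>Here \<open>y\<close> is \<zeta>, a constant with respect to \<open>x\<close>.
    As powers of ring elements, both sides fall under \<open>power_diff_sumr2\<close>.\<close>
  define x y :: "complex poly poly" where "x = [:0, 1:]" and "y = [:[:0, 1:]:]"
  have pow_y: "y ^ k = [:monom 1 k:]" for k
  proof (induction k)
    case 0
    show ?case by (simp add: one_pCons)
  next
    case (Suc k)
    then show ?case by (simp add: y_def monom_Suc)
  qed
  have pow_x: "x ^ k = monom 1 k" for k
    by (induction k) (simp_all add: x_def monom_Suc)
  have "[:- [:0, 1:], 1:] * (\<Sum>i\<le>n. monom (monom 1 (n - i)) i) =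
      (x - y) * (\<Sum>i\<le>n. y ^ (n - i) * x ^ i)"
    unfolding pow_x pow_y by (simp add: x_def y_def smult_monom)
  also have "\<dots> = x ^ Suc n - y ^ Suc n"
    using power_diff_sumr2[of x "Suc n" y] by (simp add: lessThan_Suc_atMost)
  also have "\<dots> = map_poly (\<lambda>c. [:c:]) (monom 1 (Suc n)) - [:monom 1 (Suc n):]"
    unfolding pow_x pow_y by (simp add: map_poly_monom one_pCons)
  finally show "[:- [:0, 1::complex:], 1:] * (\<Sum>i\<le>n. monom (monom 1 (n - i)) i) =
      map_poly (\<lambda>c. [:c:]) (monom 1 (Suc n)) - [:monom 1 (Suc n):]" .
qed

lemma linear_form_cauchy_prod:
  assumes "linear_form u" "linear_form v"
  shows "linear_form (cauchy_prod u v)"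
proof (rule linear_formI)
  \<comment> \<open>\<open>coeff_map_poly\<close> requires the mapped function to send 0 to
    0.\<close>
  note v0 = linear_form_0[OF assms(2)]
  show "cauchy_prod u v (p + q) = cauchy_prod u v p + cauchy_prod u v q" for p q
  proof -
    have "form_poly v (p + q) = form_poly v p + form_poly v q"
      unfolding form_poly_def distrib_left diff_quot_add
      by (intro poly_eqI) (simp add: coeff_map_poly v0 linear_form_add[OF assms(2)])
    then show ?thesis
      by (simp add: cauchy_prod_def linear_form_add[OF assms(1)])
  qed
  show "cauchy_prod u v (smult k p) = k * cauchy_prod u v p" for k p
  proof -
    have "form_poly v (smult k p) = smult k (form_poly v p)"
      unfolding form_poly_def mult_smult_right diff_quot_smult
      by (intro poly_eqI) (simp add: coeff_map_poly v0 linear_form_smult[OF assms(2)])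
    then show ?thesis
      by (simp add: cauchy_prod_def linear_form_smult[OF assms(1)])
  qed
qed

text \<open>\<open>form_poly\<close> multiplies x^n by x first, so the quotient is that of x^(n+1).
  Applying \<open>v\<close> to the powers of \<zeta> turns it into a polynomial in x with
  coefficients (v)_(n-i), on which \<open>u\<close> then acts.\<close>

lemma cauchy_prod_monom:
  assumes "linear_form u" "linear_form v"
  shows "cauchy_prod u v (monom 1 n) = (\<Sum>i\<le>n. u (monom 1 i) * v (monom 1 (n - i)))"
proof -
  note v0 = linear_form_0[OF assms(2)]
  have "[:0, 1:] * monom 1 n = (monom 1 (Suc n) :: complex poly)"
    by (simp add: monom_Suc)
  then have "form_poly v (monom 1 n) = map_poly v (\<Sum>i\<le>n. monom (monom 1 (n - i)) i)"
    unfolding form_poly_def by (simp only: diff_quot_monom)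
  also have "\<dots> = (\<Sum>i\<le>n. monom (v (monom 1 (n - i))) i)"
    by (intro poly_eqI)
      (simp add: coeff_map_poly v0 coeff_sum linear_form_sum[OF assms(2)] if_distrib[of v] cong: if_cong)
  finally show ?thesis
    using linear_form_monom[OF assms(1), of "v (monom 1 (n - i))" i for i]
    by (simp add: cauchy_prod_def linear_form_sum[OF assms(1)] mult.commute)
qed

text \<open>\<open>theta0\<close> lowers the exponent by one, so the value is the moment of the
  product at n - 1. For n = 0 it is 0, matching the empty range from 0 to -1.\<close>

lemma xinv_cauchy_prod_monom:
  assumes "linear_form u" "linear_form v"
  shows "xinv_form (cauchy_prod u v) (monom 1 n) =
    (\<Sum>\<mu> = 0..int n - 1. moment u \<mu> * moment v (int n - \<mu> - 1))"
proof (cases n)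
  case 0
  then show ?thesis
    using linear_form_0[OF linear_form_cauchy_prod[OF assms]] theta0_monom[of 1 0]
    by (simp add: xinv_form_def theta0_monom)
next
  case (Suc m)
  have "(\<Sum>\<mu> = 0..int m. moment u \<mu> * moment v (int m - \<mu>)) =
      (\<Sum>i\<le>m. u (monom 1 i) * v (monom 1 (m - i)))"
    \<comment> \<open>All indices lie between 0 and \<open>m\<close>, so the zero default of
      \<open>moment\<close> never occurs.\<close>
    by (rule sum.reindex_bij_witness[of _ int nat])
      (auto simp: moment_def nat_diff_distrib)
  with Suc show ?thesis
    by (simp add: xinv_form_def theta0_monom cauchy_prod_monom[OF assms])
qed

text \<open>The coefficient \<open>k\<close> accommodates the derivative n x^(n-1) of x^n, which
  supplies the factor n of the first sum in the recurrence.\<close>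

lemma mult_form_sum_monom:
  assumes "linear_form u"
  shows "mult_form (\<Sum>\<nu>\<le>t. monom (c \<nu>) \<nu>) u (monom k n) = k * (\<Sum>\<nu>\<le>t. c \<nu> * u (monom 1 (n + \<nu>)))"
proof -
  have "u (monom (c \<nu> * k) (\<nu> + n)) = k * (c \<nu> * u (monom 1 (n + \<nu>)))" for \<nu>
    using linear_form_monom[OF assms, of "c \<nu> * k"] by (simp add: add.commute)
  then show ?thesis
    by (simp add: mult_form_def sum_distrib_right mult_monom linear_form_sum[OF assms]
        sum_distrib_left)
qed

theorem lemma1:
  fixes u :: form
    and t p q :: nat
    and c a b :: "nat \<Rightarrow> complex"
    and \<Phi> \<psi> B :: "complex poly"
  assumes "linear_form u"
    and "regular_form u"
    and "moment u 0 = 1"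
    and "\<Phi> = (\<Sum>\<nu>\<le>t. monom (c \<nu>) \<nu>)"
    and "\<psi> = (\<Sum>\<nu>\<le>p. monom (a \<nu>) \<nu>)"
    and "B = (\<Sum>\<nu>\<le>q. monom (b \<nu>) \<nu>)"
    and "\<Phi> \<noteq> 0"
  shows "(Laguerre_Hahn_form u \<and> LH_equation \<Phi> \<psi> B u) \<longleftrightarrow>
    (\<forall>n::int. n \<ge> 0 \<longrightarrow>
       - of_int n * (\<Sum>\<nu>\<le>t. c \<nu> * moment u (n - 1 + int \<nu>))
       + (\<Sum>\<nu>\<le>p. a \<nu> * moment u (n + int \<nu>))
       + (\<Sum>\<nu>\<le>q. b \<nu> *
            (\<Sum>\<mu> = 0..n + int \<nu> - 1. moment u \<mu> * moment u (n + int \<nu> - \<mu> - 1))) = 0)"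
proof -
  note lin = \<open>linear_form u\<close>
  define v where "v = xinv_form (cauchy_prod u u)"
  have lin_v: "linear_form v"
    unfolding v_def by (intro linear_form_xinv_form linear_form_cauchy_prod lin)
  define L where "L = deriv_form (mult_form \<Phi> u) + mult_form \<psi> u + mult_form B v"
  have lin_L: "linear_form L"
    unfolding L_def
    by (intro linear_form_plus linear_form_deriv_form linear_form_mult_form lin lin_v)
  have L_monom: "L (monom 1 n) =
       - of_int (int n) * (\<Sum>\<nu>\<le>t. c \<nu> * moment u (int n - 1 + int \<nu>))
       + (\<Sum>\<nu>\<le>p. a \<nu> * moment u (int n + int \<nu>))
       + (\<Sum>\<nu>\<le>q. b \<nu> * (\<Sum>\<mu> = 0..int n + int \<nu> - 1.
            moment u \<mu> * moment u (int n + int \<nu> - \<mu> - 1)))" for n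
  proof -
    have "deriv_form (mult_form \<Phi> u) (monom 1 n) =
        - of_int (int n) * (\<Sum>\<nu>\<le>t. c \<nu> * moment u (int n - 1 + int \<nu>))"
    proof (cases n)
      \<comment> \<open>The derivative of 1 vanishes on the left; on the right the factor n = 0
        kills the sum, including its term with index -1.\<close>
      case 0
      then show ?thesis
        by (simp add: deriv_form_def pderiv_monom linear_form_0[OF linear_form_mult_form[OF lin]])
    next
      case (Suc m)
      then show ?thesis
        by (simp add: deriv_form_def pderiv_monom \<open>\<Phi> = _\<close> mult_form_sum_monom[OF lin]
            moment_def nat_add_distrib algebra_simps)
    qed
    moreover have "mult_form \<psi> u (monom 1 n) = (\<Sum>\<nu>\<le>p. a \<nu> * moment u (int n + int \<nu>))"
      by (simp add: \<open>\<psi> = _\<close> mult_form_sum_monom[OF lin] moment_def nat_add_distrib)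
    moreover have "mult_form B v (monom 1 n) =
        (\<Sum>\<nu>\<le>q. b \<nu> * (\<Sum>\<mu> = 0..int n + int \<nu> - 1.
            moment u \<mu> * moment u (int n + int \<nu> - \<mu> - 1)))"
      unfolding \<open>B = _\<close> mult_form_sum_monom[OF lin_v]
      by (simp add: v_def xinv_cauchy_prod_monom[OF lin lin])
    ultimately show ?thesis
      by (simp add: L_def)
  qed
  \<comment> \<open>The hypotheses give regularity, normalisation and \<Phi> \<noteq> 0, and the
    given polynomials are themselves the witnesses for the existential in
    \<open>Laguerre_Hahn_form\<close>.\<close>
  have "Laguerre_Hahn_form u \<and> LH_equation \<Phi> \<psi> B u \<longleftrightarrow> L = 0"
    using assms(1-3,7) unfolding Laguerre_Hahn_form_def L_def v_def LH_equation_def by blast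
  also have "\<dots> \<longleftrightarrow> (\<forall>n. L (monom 1 n) = 0)"
    by (rule linear_form_eq_0_iff[OF lin_L])
  finally have "Laguerre_Hahn_form u \<and> LH_equation \<Phi> \<psi> B u \<longleftrightarrow> (\<forall>n. L (monom 1 n) = 0)" .
  \<comment> \<open>The recurrence ranges over integers, where n - 1 + \<nu> can be -1, whereas
    monomials have natural exponents.\<close>
  moreover have "(\<forall>n::int. n \<ge> 0 \<longrightarrow> P n) \<longleftrightarrow> (\<forall>n. P (int n))" for P
    by (metis nonneg_int_cases of_nat_0_le_iff)
  ultimately show ?thesis
    by (simp only: L_monom)
qed

end
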